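(* Let $P$ be a partially ordered set and let $F\subseteq P^P$ be a set of functions $P\to P$. Let $(x_\gamma)_{\gamma\in\Gamma}$ be a net in $P$ that $FO_2$-converges to $x\in P$. Then $(x_\gamma)_{\gamma\in\Gamma}$ has a subnet that $FO_1$-converges to $x$. In particular, if a net $(x_\gamma)_{\gamma\in\Gamma}$ in $P$ is $O_2$-convergent to $x\in P$, then $(x_\gamma)_{\gamma\in\Gamma}$ has a subnet that $O_1$-converges to $x$.
   Context: Let $P$ be a poset. A subset $D\subseteq P$ is directed if it is nonempty and every finite subset of $D$ has an upper bound in $D$; dually, a nonempty subset is filtered if every finite subset of it has a lower bound in it. $[a,b]:=\{x\in P: a\le x\le b\}$. Subnets: if $(x_\gamma)_{\gamma\in\Gamma}$ is a net, $\Gamma'$ is a directed set, and $\varphi:\Gamma'\to\Gamma$ is increasing and final (for every $\gamma\in\Gamma$ there is $\gamma'\in\Gamma'$ with $\varphi(\gamma')\ge\gamma$), then $(x_{\varphi(\gamma')})_{\gamma'\in\Gamma'}$ is called a subnet of $(x_\gamma)_{\gamma\in\Gamma}$. A property holds eventually for a net if there is $\gamma_0\in\Gamma$ such that it holds for the subnet $(x_\gamma)_{\gamma\ge\gamma_0}$. $x_\gamma\uparrow x$ means the net is increasing with supremum $x$; $x_\gamma\downarrow x$ means it is decreasing with infimum $x$. $O_1$-convergence: $(x_\gamma)_{\gamma\in\Gamma}$ $O_1$-converges to $x$ if there are nets $(y_\gamma)_{\gamma\in\Gamma}$, $(z_\gamma)_{\gamma\in\Gamma}$ in $P$ (same index set)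 such that $y_\gamma\uparrow x$, $z_\gamma\downarrow x$ and eventually $y_\gamma\le x_\gamma\le z_\gamma$. $O_2$-convergence: $(x_\gamma)_{\gamma\in\Gamma}$ $O_2$-converges to $x$ if there are a directed subset $M\subseteq P$ and a filtered subset $N\subseteq P$ with $\sup M=\inf N=x$ such that for every $(m,n)\in M\times N$ the net is eventually contained in $[m,n]$. For $F\subseteq P^P$ and $i\in\{1,2\}$, the net $(x_\gamma)$ $FO_i$-converges to $x$ if $(f(x_\gamma))_{\gamma\in\Gamma}$ $O_i$-converges to $f(x)$ for every $f\in F$. *)

theory Defs
  imports "HOL-Library.Lub_Glb" "HOL-Library.FuncSet"
begin

definition directed_wrt :: "('a \<times> 'a) set \<Rightarrow> 'a set \<Rightarrow> bool" where
  "directed_wrt r D \<longleftrightarrow> D \<noteq> {} \<and> (\<forall>S\<subseteq>D. finite S \<longrightarrow> (\<exists>u\<in>D. \<forall>s\<in>S. (s, u) \<in> r))"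

definition directed_subset :: "'a::order set \<Rightarrow> bool" where
  "directed_subset M \<longleftrightarrow> directed_wrt {(a, b). a \<le> b} M"

definition filtered_subset :: "'a::order set \<Rightarrow> bool" where
  "filtered_subset N \<longleftrightarrow> directed_wrt {(a, b). b \<le> a} N"

text \<open>
  A net in a poset is given by an index set \<open>G\<close>, a relation \<open>r\<close> directing it
  (\<open>(i, j) \<in> r\<close> stands for \<open>i \<le> j\<close>), and a function of which only the values on \<open>G\<close> matter.
  As is usual for nets, the relation need not be antisymmetric; to cover also the convention that
  nets are indexed by directed posets, statements asserting the existence of a subnet add that
  antisymmetry passes to its index set.
\<close>

definition directed_index :: "'i set \<Rightarrow> ('i \<times> 'i) set \<Rightarrow> bool" where
  "directed_index G r \<longleftrightarrow> preorder_on G r \<and> directed_wrt r G"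

definition net_eventually :: "'i set \<Rightarrow> ('i \<times> 'i) set \<Rightarrow> ('i \<Rightarrow> bool) \<Rightarrow> bool" where
  "net_eventually G r Q \<longleftrightarrow> (\<exists>i0\<in>G. \<forall>i\<in>G. (i0, i) \<in> r \<longrightarrow> Q i)"

definition net_up :: "'i set \<Rightarrow> ('i \<times> 'i) set \<Rightarrow> ('i \<Rightarrow> 'a::order) \<Rightarrow> 'a \<Rightarrow> bool" where
  "net_up G r y l \<longleftrightarrow> monotone_on G (\<lambda>i j. (i, j) \<in> r) (\<le>) y \<and> isLub UNIV (y ` G) l"

definition net_down :: "'i set \<Rightarrow> ('i \<times> 'i) set \<Rightarrow> ('i \<Rightarrow> 'a::order) \<Rightarrow> 'a \<Rightarrow> bool" where
  "net_down G r z l \<longleftrightarrow> monotone_on G (\<lambda>i j. (i, j) \<in> r) (\<ge>) z \<and> isGlb UNIV (z ` G) l"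

definition O1_converges :: "'i set \<Rightarrow> ('i \<times> 'i) set \<Rightarrow> ('i \<Rightarrow> 'a::order) \<Rightarrow> 'a \<Rightarrow> bool" where
  "O1_converges G r x l \<longleftrightarrow>
     (\<exists>y z. net_up G r y l \<and> net_down G r z l \<and>
            net_eventually G r (\<lambda>i. y i \<le> x i \<and> x i \<le> z i))"

definition O2_converges :: "'i set \<Rightarrow> ('i \<times> 'i) set \<Rightarrow> ('i \<Rightarrow> 'a::order) \<Rightarrow> 'a \<Rightarrow> bool" where
  "O2_converges G r x l \<longleftrightarrow>
     (\<exists>M N. directed_subset M \<and> filtered_subset N \<and> isLub UNIV M l \<and> isGlb UNIV N l \<and>
            (\<forall>m\<in>M. \<forall>n\<in>N. net_eventually G r (\<lambda>i. x i \<in> {m..n})))"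

definition FO1_converges ::
    "('a \<Rightarrow> 'a) set \<Rightarrow> 'i set \<Rightarrow> ('i \<times> 'i) set \<Rightarrow> ('i \<Rightarrow> 'a::order) \<Rightarrow> 'a \<Rightarrow> bool" where
  "FO1_converges F G r x l \<longleftrightarrow> (\<forall>f\<in>F. O1_converges G r (\<lambda>i. f (x i)) (f l))"

definition FO2_converges ::
    "('a \<Rightarrow> 'a) set \<Rightarrow> 'i set \<Rightarrow> ('i \<times> 'i) set \<Rightarrow> ('i \<Rightarrow> 'a::order) \<Rightarrow> 'a \<Rightarrow> bool" where
  "FO2_converges F G r x l \<longleftrightarrow> (\<forall>f\<in>F. O2_converges G r (\<lambda>i. f (x i)) (f l))"

text \<open>
  \<open>subnet_map G r G' r' \<phi>\<close>: for every net \<open>x\<close> over \<open>(G, r)\<close>, the composition \<open>x \<circ> \<phi>\<close> over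
  \<open>(G', r')\<close> is a subnet of \<open>x\<close>.
\<close>

definition subnet_map ::
    "'i set \<Rightarrow> ('i \<times> 'i) set \<Rightarrow> 'j set \<Rightarrow> ('j \<times> 'j) set \<Rightarrow> ('j \<Rightarrow> 'i) \<Rightarrow> bool" where
  "subnet_map G r G' r' \<phi> \<longleftrightarrow>
     directed_index G' r' \<and> \<phi> \<in> G' \<rightarrow> G \<and>
     monotone_on G' (\<lambda>i j. (i, j) \<in> r') (\<lambda>i j. (i, j) \<in> r) \<phi> \<and>
     (\<forall>i\<in>G. \<exists>j\<in>G'. (i, \<phi> j) \<in> r)"

text \<open>
  HOL cannot quantify existentially over the type carrying the index set of a subnet, so a
  sufficiently large type is fixed: its elements pair an index with a set of triples
  \<open>(f, m, n)\<close>, where \<open>f\<close> is a self-map and \<open>m, n\<close> are bounds in the poset.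
\<close>

type_synonym ('i, 'a) subnet_index = "'i \<times> (('a \<Rightarrow> 'a) \<times> 'a \<times> 'a) set"

end

theory Submission
  imports Defs
begin

text \<open>
  Choose, for every \<open>f\<close> in \<open>F\<close>, sets \<open>M f\<close> and \<open>N f\<close> witnessing the \<open>O\<^sub>2\<close>-convergence of \<open>f \<circ> x\<close>.
  The subnet is indexed by pairs \<open>(i, S)\<close>, where \<open>S\<close> is the graph of a finite partial selection
  assigning to \<open>f\<close> bounds \<open>(m, n)\<close> in \<open>M f \<times> N f\<close> such that \<open>f (x k)\<close> lies in \<open>[m, n]\<close> for
  all \<open>k \<ge> i\<close>; larger indices have larger domains and narrower intervals. Reading the bounds
  off \<open>S\<close> gives the monotone nets of \<open>O\<^sub>1\<close>-convergence. Since monotonicity is required on the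
  whole index set, but \<open>S\<close> selects bounds for finitely many \<open>f\<close> only, a fixed pair \<open>q0 f\<close> is
  used outside the domain of \<open>S\<close>, and all selected bounds are required to refine it.
\<close>

section \<open>Directed sets, eventual properties and cofinal subsets\<close>

lemma directed_wrt_pairD:
  assumes "directed_wrt r D" "a \<in> D" "b \<in> D"
  obtains u where "u \<in> D" "(a, u) \<in> r" "(b, u) \<in> r"
proof -
  have "{a, b} \<subseteq> D" "finite {a, b}" using assms by auto
  then obtain u where "u \<in> D" "\<forall>s\<in>{a, b}. (s, u) \<in> r"
    using assms(1) unfolding directed_wrt_def by meson
  then show ?thesis using that by simp
qed

lemma directed_wrtI_pair:
  assumes "D \<noteq> {}" "trans r"
    and pair: "\<And>a b. a \<in> D \<Longrightarrow> b \<in> D \<Longrightarrow> \<exists>u\<in>D. (a, u) \<in> r \<and> (b, u) \<in> r"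
  shows "directed_wrt r D"
  unfolding directed_wrt_def
proof (intro conjI allI impI)
  fix S assume "S \<subseteq> D" "finite S"
  from this(2,1) show "\<exists>u\<in>D. \<forall>s\<in>S. (s, u) \<in> r"
  proof (induction S)
    case empty
    then show ?case using assms(1) by auto
  next
    case (insert a S)
    then obtain u where u: "u \<in> D" "\<forall>s\<in>S. (s, u) \<in> r" by auto
    moreover from insert u obtain v where "v \<in> D" "(a, v) \<in> r" "(u, v) \<in> r"
      using pair by blast
    ultimately show ?case using transD[OF assms(2)] by blast
  qed
qed (fact assms(1))

text \<open>Finitely many thresholds have a common upper bound in a directed index set, and by
  transitivity everything beyond it lies beyond each of them.\<close>

lemma net_eventually_finite_ball:
  assumes "directed_index G r" "finite A" "\<And>a. a \<in> A \<Longrightarrow> net_eventually G r (Q a)"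
  shows "net_eventually G r (\<lambda>i. \<forall>a\<in>A. Q a i)"
proof -
  obtain h where h: "\<And>a. a \<in> A \<Longrightarrow> h a \<in> G \<and> (\<forall>i\<in>G. (h a, i) \<in> r \<longrightarrow> Q a i)"
    using assms(3) unfolding net_eventually_def by metis
  have "h ` A \<subseteq> G" "finite (h ` A)" using h assms(2) by auto
  then obtain u where u: "u \<in> G" "\<forall>s\<in>h ` A. (s, u) \<in> r"
    using assms(1) unfolding directed_index_def directed_wrt_def by meson
  have "trans r" using assms(1) by (simp add: directed_index_def preorder_on_def)
  then show ?thesis unfolding net_eventually_def
    using u h by (intro bexI[of _ u]) (blast dest: transD)+
qed

text \<open>Cofinality makes \<open>Y\<close> and \<open>M\<close> have exactly the same upper
  bounds.\<close>

lemma isLub_cofinal_subset: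
  assumes "isLub UNIV M (l::'a::order)" "Y \<subseteq> M" "\<And>m. m \<in> M \<Longrightarrow> \<exists>y\<in>Y. m \<le> y"
  shows "isLub UNIV Y l"
proof -
  have "isUb UNIV Y = isUb UNIV M"
    unfolding fun_eq_iff isUb_def setle_def using assms(2,3) by (meson order.trans subsetD)
  then show ?thesis using assms(1) by (simp add: isLub_def)
qed

lemma isGlb_coinitial_subset:
  assumes "isGlb UNIV N (l::'a::order)" "Y \<subseteq> N" "\<And>n. n \<in> N \<Longrightarrow> \<exists>y\<in>Y. y \<le> n"
  shows "isGlb UNIV Y l"
proof -
  have "isLb UNIV Y = isLb UNIV N"
    unfolding fun_eq_iff isLb_def setge_def using assms(2,3) by (meson order.trans subsetD)
  then show ?thesis using assms(1) by (simp add: isGlb_def)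
qed

section \<open>Construction of the subnet\<close>

text \<open>Abstract core: \<open>Q f\<close> stands for the available bounds, \<open>le\<close> for
  refinement, and \<open>R f q i\<close> says that the net obeys the bound \<open>q\<close> at
  \<open>i\<close>. One subnet must serve all \<open>f\<close> at once, even for infinite
  \<open>F\<close>; this works because each index commits to finitely many bounds only.\<close>

lemma subnet_with_monotone_selections:
  fixes F :: "'f set" and Q :: "'f \<Rightarrow> 'b set" and le :: "'b \<Rightarrow> 'b \<Rightarrow> bool"
    and R :: "'f \<Rightarrow> 'b \<Rightarrow> 'i \<Rightarrow> bool"
  assumes G: "directed_index G r"
    and le: "reflp le" "transp le" "antisymp le"
    and Q: "\<And>f. f \<in> F \<Longrightarrow> directed_wrt {(a, b). le a b} (Q f)"
    and R: "\<And>f q. f \<in> F \<Longrightarrow> q \<in> Q f \<Longrightarrow> net_eventually G r (R f q)"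
  obtains G' :: "('i \<times> ('f \<times> 'b) set) set" and r' \<phi> c
  where "subnet_map G r G' r' \<phi>" "antisym r \<Longrightarrow> antisym r'"
    "\<And>f. f \<in> F \<Longrightarrow> monotone_on G' (\<lambda>i j. (i, j) \<in> r') le (c f)"
    "\<And>f. f \<in> F \<Longrightarrow> c f ` G' \<subseteq> Q f"
    "\<And>f q. f \<in> F \<Longrightarrow> q \<in> Q f \<Longrightarrow> \<exists>j\<in>G'. le q (c f j)"
    "\<And>f. f \<in> F \<Longrightarrow> net_eventually G' r' (\<lambda>j. R f (c f j) (\<phi> j))"
proof -
  have rr: "r \<subseteq> G \<times> G" "trans r" "\<And>i. i \<in> G \<Longrightarrow> (i, i) \<in> r"
    and dG: "directed_wrt r G"
    using G by (auto simp: directed_index_def preorder_on_def refl_on_def)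
  have le_refl: "le a a" for a using le(1) by (simp add: reflp_def)
  have le_trans: "le a b \<Longrightarrow> le b d \<Longrightarrow> le a d" for a b d using le(2) by (meson transpD)
  have le_antisym: "le a b \<Longrightarrow> le b a \<Longrightarrow> a = b" for a b using le(3) by (meson antisympD)
  have "\<exists>q. q \<in> Q f" if "f \<in> F" for f
    using Q[OF that] by (auto simp: directed_wrt_def)
  then obtain q0 where q0: "\<And>f. f \<in> F \<Longrightarrow> q0 f \<in> Q f" by metis
  define adm where "adm S \<longleftrightarrow> finite S \<and> single_valued S \<and>
      (\<forall>(f, q)\<in>S. f \<in> F \<and> q \<in> Q f \<and> le (q0 f) q)" for S :: "('f \<times> 'b) set"
  define G' where "G' = {(i, S). i \<in> G \<and> adm S \<and>
      (\<forall>(f, q)\<in>S. \<forall>k\<in>G. (i, k) \<in> r \<longrightarrow> R f q k)}"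
  \<comment> \<open>As \<open>T\<close> is single-valued, \<open>q'\<close> is the one bound that
    \<open>T\<close> selects for \<open>f\<close>; its existence also forces the domain of
    \<open>S\<close> into that of \<open>T\<close>.\<close>
  define r' where "r' = {((i, S), (j, T)). (i, S) \<in> G' \<and> (j, T) \<in> G' \<and> (i, j) \<in> r \<and>
      (\<forall>(f, q)\<in>S. \<exists>q'. (f, q') \<in> T \<and> le q q')}"
  define c where "c f p = (if f \<in> Domain (snd p) then THE q. (f, q) \<in> snd p else q0 f)"
    for f and p :: "'i \<times> ('f \<times> 'b) set"
  have c_eq: "c f (i, S) = q" if "single_valued S" "(f, q) \<in> S" for f q S i
    using that unfolding c_def single_valued_def by auto
  have c_default: "c f (i, S) = q0 f" if "f \<notin> Domain S" for f i S
    using that by (simp add: c_def)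
  have c_adm: "c f (i, S) \<in> Q f \<and> le (q0 f) (c f (i, S))" if "adm S" "f \<in> F" for f S i
  proof (cases "f \<in> Domain S")
    case True
    then obtain q where "(f, q) \<in> S" by auto
    then show ?thesis using that c_eq[of S f q i] unfolding adm_def by auto
  qed (use c_default q0 that le_refl in simp)
  \<comment> \<open>Finiteness of \<open>S\<close> enters here: its finitely many eventual
    conditions hold jointly from some \<open>a\<close> on, so any \<open>k\<close> beyond
    \<open>a\<close>, \<open>i\<close> and \<open>j\<close> carries \<open>S\<close>.\<close>
  have extend: "\<exists>k. (k, S) \<in> G' \<and> (i, k) \<in> r \<and> (j, k) \<in> r"
    if S: "adm S" and ij: "i \<in> G" "j \<in> G" for S i j
  proof -
    have "net_eventually G r (\<lambda>i. \<forall>p\<in>S. R (fst p) (snd p) i)"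
      using S unfolding adm_def by (intro net_eventually_finite_ball[OF G]) (fastforce intro: R)+
    then obtain a where a: "a \<in> G" "\<forall>k\<in>G. (a, k) \<in> r \<longrightarrow> (\<forall>p\<in>S. R (fst p) (snd p) k)"
      unfolding net_eventually_def by blast
    obtain b where b: "b \<in> G" "(i, b) \<in> r" "(j, b) \<in> r" using directed_wrt_pairD[OF dG ij] .
    obtain k where k: "k \<in> G" "(a, k) \<in> r" "(b, k) \<in> r"
      using directed_wrt_pairD[OF dG a(1) b(1)] .
    have "(k, S) \<in> G'"
      unfolding G'_def using S k(1) a(2) transD[OF rr(2) k(2)] by fastforce
    then show ?thesis using b k transD[OF rr(2)] by blast
  qed
  have single: "\<exists>k. (k, {(f, q)}) \<in> G'" if "f \<in> F" "q \<in> Q f" "le (q0 f) q" for f q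
  proof -
    obtain i where "i \<in> G" using dG by (auto simp: directed_wrt_def)
    moreover have "adm {(f, q)}" using that by (auto simp: adm_def single_valued_def)
    ultimately show ?thesis using extend by blast
  qed
  \<comment> \<open>The empty selection imposes no condition, so every index of \<open>G\<close>
    occurs in \<open>G'\<close>; hence \<open>G'\<close> is nonempty and \<open>fst\<close> is
    final.\<close>
  have G'_empty: "(i, {}) \<in> G'" if "i \<in> G" for i
    using that by (simp add: G'_def adm_def)
  have r'_trans: "trans r'"
  proof (rule transI, clarsimp simp: r'_def, intro conjI)
    fix i S j T k U
    assume ij: "(i, j) \<in> r" "(j, k) \<in> r"
      and S: "\<forall>x\<in>S. case x of (f, q) \<Rightarrow> \<exists>q'. (f, q') \<in> T \<and> le q q'"
      and T: "\<forall>x\<in>T. case x of (f, q) \<Rightarrow> \<exists>q'. (f, q') \<in> U \<and> le q q'"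
    show "(i, k) \<in> r" using ij transD[OF rr(2)] by blast
    show "\<forall>x\<in>S. case x of (f, q) \<Rightarrow> \<exists>q'. (f, q') \<in> U \<and> le q q'"
      using S T le_trans by (fast elim!: ballE)
  qed
  have pre: "preorder_on G' r'"
    unfolding preorder_on_def using r'_trans rr(3) le_refl
    by (auto simp: r'_def refl_on_def G'_def)
  have pair: "\<exists>u\<in>G'. (p, u) \<in> r' \<and> (p', u) \<in> r'" if "p \<in> G'" "p' \<in> G'" for p p'
  proof -
    obtain i S j T where p: "p = (i, S)" "p' = (j, T)" by fastforce
    have S: "adm S" "i \<in> G" and T: "adm T" "j \<in> G" using that p by (auto simp: G'_def)
    \<comment> \<open>Comparing values of \<open>c\<close> rather than pairs of \<open>S\<close> and
      \<open>T\<close> treats all cases alike: an \<open>f\<close> in only one of the domains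
      contributes \<open>q0 f\<close> from the other side.\<close>
    have "\<exists>q\<in>Q f. le (c f (i, S)) q \<and> le (c f (j, T)) q" if "f \<in> F" for f
      using directed_wrt_pairD[OF Q[OF that], of "c f (i, S)" "c f (j, T)"] c_adm S T that
      by (metis case_prodD mem_Collect_eq)
    then obtain w where w: "\<And>f. f \<in> F \<Longrightarrow> w f \<in> Q f \<and> le (c f (i, S)) (w f) \<and> le (c f (j, T)) (w f)"
      by metis
    define W where "W = (\<lambda>f. (f, w f)) ` (Domain S \<union> Domain T)"
    have "Domain S \<union> Domain T \<subseteq> F" using S T by (auto simp: adm_def)
    moreover have "finite (Domain S \<union> Domain T)"
      using S T by (auto simp: adm_def finite_Domain)
    moreover have "le (q0 f) (w f)" if "f \<in> F" for f
      using c_adm[OF S(1) that] w[OF that] le_trans by blast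
    ultimately have "adm W" using w by (auto simp: adm_def W_def single_valued_def)
    then obtain k where k: "(k, W) \<in> G'" "(i, k) \<in> r" "(j, k) \<in> r"
      using extend S(2) T(2) by blast
    have "\<exists>q'. (f, q') \<in> W \<and> le q q'" if "(f, q) \<in> S" for f q
      using that c_eq[of S f q i] w[of f] S(1) by (force simp: W_def adm_def)
    moreover have "\<exists>q'. (f, q') \<in> W \<and> le q q'" if "(f, q) \<in> T" for f q
      using that c_eq[of T f q j] w[of f] T(1) by (force simp: W_def adm_def)
    ultimately show ?thesis using k that p by (intro bexI[of _ "(k, W)"]) (auto simp: r'_def)
  qed
  have "G' \<noteq> {}" using dG G'_empty by (auto simp: directed_wrt_def)
  then have "directed_index G' r'"
    unfolding directed_index_def using pre directed_wrtI_pair[OF _ r'_trans pair] by blast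
  moreover have "fst \<in> G' \<rightarrow> G" by (auto simp: G'_def)
  moreover have "monotone_on G' (\<lambda>i j. (i, j) \<in> r') (\<lambda>i j. (i, j) \<in> r) fst"
    by (auto simp: monotone_on_def r'_def)
  moreover have "\<exists>j\<in>G'. (i, fst j) \<in> r" if "i \<in> G" for i
    using G'_empty[OF that] rr(3)[OF that] by force
  ultimately have subnet: "subnet_map G r G' r' fst" by (simp add: subnet_map_def)
  have anti: "antisym r'" if "antisym r"
  proof (rule antisymI, clarify)
    fix i S j T assume *: "((i, S), (j, T)) \<in> r'" "((j, T), (i, S)) \<in> r'"
    \<comment> \<open>Going from \<open>S\<close> to \<open>T\<close> and back gives
      \<open>le q q'\<close> and \<open>le q' q''\<close> with \<open>q''\<close> again selected by
      \<open>S\<close> for \<open>f\<close>. So \<open>q'' = q\<close>, and antisymmetry of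
      \<open>le\<close> gives \<open>q' = q\<close>.\<close>
    have sub: "S \<subseteq> T" if ST: "((i, S), (j, T)) \<in> r'" "((j, T), (i, S)) \<in> r'" for i S j T
    proof clarify
      fix f q assume q: "(f, q) \<in> S"
      then obtain q' where q': "(f, q') \<in> T" "le q q'" using ST(1) by (auto simp: r'_def)
      then obtain q'' where q'': "(f, q'') \<in> S" "le q' q''" using ST(2) by (auto simp: r'_def)
      have "single_valued S" using ST(1) by (auto simp: r'_def G'_def adm_def)
      then have "q'' = q" using q q'' by (meson single_valuedD)
      then show "(f, q) \<in> T" using q' q'' le_antisym by blast
    qed
    show "i = j \<and> S = T"
      using * sub[of i S j T] sub[of j T i S] antisymD[OF that, of i j] by (auto simp: r'_def)
  qed
  have mono: "monotone_on G' (\<lambda>i j. (i, j) \<in> r') le (c f)" if f: "f \<in> F" for f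
  proof (rule monotone_onI, clarify)
    fix i S j T assume *: "((i, S), (j, T)) \<in> r'"
    then have S: "adm S" and T: "adm T" by (auto simp: r'_def G'_def)
    \<comment> \<open>If \<open>S\<close> selects no bound for \<open>f\<close>, the left side is
      \<open>q0 f\<close>, which every value of \<open>c f\<close> on an admissible selection
      refines.\<close>
    show "le (c f (i, S)) (c f (j, T))"
    proof (cases "f \<in> Domain S")
      case True
      then obtain q where q: "(f, q) \<in> S" by auto
      then obtain q' where "(f, q') \<in> T" "le q q'" using * by (auto simp: r'_def)
      then show ?thesis using q S T c_eq[of S f q] c_eq[of T f q'] by (simp add: adm_def)
    qed (use c_default c_adm[OF T f] in simp)
  qed
  have range: "c f ` G' \<subseteq> Q f" if "f \<in> F" for f
    using c_adm that by (auto simp: G'_def)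
  have cofinal: "\<exists>j\<in>G'. le q (c f j)" if f: "f \<in> F" and q: "q \<in> Q f" for f q
  proof -
    \<comment> \<open>The given \<open>q\<close> need not refine \<open>q0 f\<close>, so
      \<open>{(f, q)}\<close> may fail to be admissible; a common refinement \<open>u\<close> is
      selected instead.\<close>
    obtain u where u: "u \<in> Q f" "le q u" "le (q0 f) u"
      using directed_wrt_pairD[OF Q[OF f] q q0[OF f]] by blast
    then obtain k where "(k, {(f, u)}) \<in> G'" using single f by blast
    then show ?thesis
      using u c_eq[of "{(f, u)}" f u k] by (intro bexI) (auto simp: single_valued_def)
  qed
  have ev: "net_eventually G' r' (\<lambda>j. R f (c f j) (fst j))" if f: "f \<in> F" for f
  proof -
    \<comment> \<open>The default bound guarantees nothing about the net. Beyond this threshold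
      \<open>f\<close> lies in the domain of the selection, so \<open>c f\<close> is a bound the net
      obeys from \<open>j\<close> on, in particular at \<open>j\<close> itself.\<close>
    obtain k where k: "(k, {(f, q0 f)}) \<in> G'" using single f q0 le_refl by blast
    have "R f (c f (j, T)) j" if *: "((k, {(f, q0 f)}), (j, T)) \<in> r'" for j T
    proof -
      obtain q where "(f, q) \<in> T" "single_valued T" "R f q j"
        using * rr(3) by (fastforce simp: r'_def G'_def adm_def)
      then show ?thesis using c_eq[of T f q j] by simp
    qed
    then show ?thesis using k unfolding net_eventually_def by (intro bexI) auto
  qed
  show thesis by (rule that[OF subnet anti mono range cofinal ev])
qed

section \<open>From interval bounds to monotone nets\<close>

lemma FO2_converges_imp_subnet_FO1_converges:
  fixes F :: "('a::order \<Rightarrow> 'a) set" and G :: "'i set" and x :: "'i \<Rightarrow> 'a"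
  assumes G: "directed_index G r" and x: "FO2_converges F G r x l"
  shows "\<exists>(G' :: ('i, 'a) subnet_index set) r' \<phi>.
    subnet_map G r G' r' \<phi> \<and> (antisym r \<longrightarrow> antisym r') \<and> FO1_converges F G' r' (x \<circ> \<phi>) l"
proof -
  define W where "W f M N \<longleftrightarrow> directed_subset M \<and> filtered_subset N \<and>
      isLub UNIV M (f l) \<and> isGlb UNIV N (f l) \<and>
      (\<forall>m\<in>M. \<forall>n\<in>N. net_eventually G r (\<lambda>i. f (x i) \<in> {m..n}))" for f :: "'a \<Rightarrow> 'a" and M N
  have "\<forall>f\<in>F. \<exists>M N. W f M N"
    using x unfolding FO2_converges_def O2_converges_def W_def .
  then obtain M N where "\<And>f. f \<in> F \<Longrightarrow> W f (M f) (N f)" by metis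
  then have MN:
    "\<And>f. f \<in> F \<Longrightarrow> directed_subset (M f)" "\<And>f. f \<in> F \<Longrightarrow> filtered_subset (N f)"
    "\<And>f. f \<in> F \<Longrightarrow> isLub UNIV (M f) (f l)" "\<And>f. f \<in> F \<Longrightarrow> isGlb UNIV (N f) (f l)"
    "\<And>f m n. f \<in> F \<Longrightarrow> m \<in> M f \<Longrightarrow> n \<in> N f \<Longrightarrow>
      net_eventually G r (\<lambda>i. f (x i) \<in> {m..n})"
    by (simp_all add: W_def)
  \<comment> \<open>Larger pairs are narrower intervals, so \<open>M f \<times> N f\<close> is
    directed: upwards in the first component, downwards in the second.\<close>
  define le where "le p q \<longleftrightarrow> fst p \<le> fst q \<and> snd q \<le> snd p" for p q :: "'a \<times> 'a"
  define Q where "Q f = M f \<times> N f" for f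
  define R where "R f p i \<longleftrightarrow> f (x i) \<in> {fst p..snd p}" for f and p :: "'a \<times> 'a" and i
  have le: "reflp le" "transp le" "antisymp le"
    by (auto simp: le_def reflp_def transp_def antisymp_def prod_eq_iff
        intro: order_trans)
  have M_ne: "M f \<noteq> {}" and N_ne: "N f \<noteq> {}" if "f \<in> F" for f
    using MN(1,2)[OF that]
    by (auto simp: directed_subset_def filtered_subset_def directed_wrt_def)
  have Q: "directed_wrt {(a, b). le a b} (Q f)" if f: "f \<in> F" for f
  proof (rule directed_wrtI_pair)
    show "Q f \<noteq> {}" using M_ne[OF f] N_ne[OF f] by (simp add: Q_def)
    show "trans {(a, b). le a b}" using le(2) by (simp add: transp_trans)
    fix a b assume ab: "a \<in> Q f" "b \<in> Q f"
    then have "fst a \<in> M f" "fst b \<in> M f" and snd: "snd a \<in> N f" "snd b \<in> N f"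
      by (auto simp: Q_def)
    then obtain m where "m \<in> M f" "fst a \<le> m" "fst b \<le> m"
      using directed_wrt_pairD[OF MN(1)[OF f, unfolded directed_subset_def]] by blast
    moreover obtain n where "n \<in> N f" "n \<le> snd a" "n \<le> snd b"
      using directed_wrt_pairD[OF MN(2)[OF f, unfolded filtered_subset_def] snd] by blast
    ultimately show "\<exists>u\<in>Q f. (a, u) \<in> {(a, b). le a b} \<and> (b, u) \<in> {(a, b). le a b}"
      by (intro bexI[of _ "(m, n)"]) (auto simp: le_def Q_def)
  qed
  have R: "net_eventually G r (R f q)" if "f \<in> F" "q \<in> Q f" for f q
    using MN(5)[of f "fst q" "snd q"] that by (auto simp: Q_def R_def[abs_def])
  obtain G' :: "('i, 'a) subnet_index set" and r' \<phi> c where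
    subnet: "subnet_map G r G' r' \<phi>" "antisym r \<Longrightarrow> antisym r'"
    and mono: "\<And>f. f \<in> F \<Longrightarrow> monotone_on G' (\<lambda>i j. (i, j) \<in> r') le (c f)"
    and range: "\<And>f. f \<in> F \<Longrightarrow> c f ` G' \<subseteq> Q f"
    and cofinal: "\<And>f q. f \<in> F \<Longrightarrow> q \<in> Q f \<Longrightarrow> \<exists>j\<in>G'. le q (c f j)"
    and ev: "\<And>f. f \<in> F \<Longrightarrow> net_eventually G' r' (\<lambda>j. R f (c f j) (\<phi> j))"
    by (rule subnet_with_monotone_selections[OF G le, of F Q R, OF Q R]) (assumption | rule that)+
  have "O1_converges G' r' (\<lambda>j. f ((x \<circ> \<phi>) j)) (f l)" if f: "f \<in> F" for f
    unfolding O1_converges_def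
  proof (intro exI conjI)
    \<comment> \<open>Cofinality is known for pairs only, so \<open>m\<close> is completed by an
      arbitrary element of the nonempty \<open>N f\<close>. The projections of \<open>c f\<close>
      are then cofinal in \<open>M f\<close> and coinitial in \<open>N f\<close>, which preserves
      the supremum and the infimum.\<close>
    have "\<exists>y\<in>(fst \<circ> c f) ` G'. m \<le> y" if "m \<in> M f" for m
      using cofinal[OF f] that N_ne[OF f] by (force simp: Q_def le_def)
    moreover have "(fst \<circ> c f) ` G' \<subseteq> M f" using range[OF f] by (auto simp: Q_def)
    ultimately show "net_up G' r' (fst \<circ> c f) (f l)"
      unfolding net_up_def using mono[OF f] isLub_cofinal_subset[OF MN(3)[OF f]]
      by (auto simp: monotone_on_def le_def)
    have "\<exists>y\<in>(snd \<circ> c f) ` G'. y \<le> n" if "n \<in> N f" for n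
      using cofinal[OF f] that M_ne[OF f] by (force simp: Q_def le_def)
    moreover have "(snd \<circ> c f) ` G' \<subseteq> N f" using range[OF f] by (auto simp: Q_def)
    ultimately show "net_down G' r' (snd \<circ> c f) (f l)"
      unfolding net_down_def using mono[OF f] isGlb_coinitial_subset[OF MN(4)[OF f]]
      by (auto simp: monotone_on_def le_def)
    show "net_eventually G' r' (\<lambda>j. (fst \<circ> c f) j \<le> f ((x \<circ> \<phi>) j) \<and>
        f ((x \<circ> \<phi>) j) \<le> (snd \<circ> c f) j)"
      using ev[OF f] by (simp add: R_def)
  qed
  then show ?thesis using subnet unfolding FO1_converges_def by blast
qed

theorem theorem2p4:
  fixes F :: "('a::order \<Rightarrow> 'a) set"
    and G :: "'i set" and r :: "('i \<times> 'i) set"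
    and x :: "'i \<Rightarrow> 'a" and l :: 'a
  assumes "directed_index G r"
  shows "(FO2_converges F G r x l \<longrightarrow>
           (\<exists>(G' :: ('i, 'a) subnet_index set) r' \<phi>.
              subnet_map G r G' r' \<phi> \<and> (antisym r \<longrightarrow> antisym r') \<and>
              FO1_converges F G' r' (x \<circ> \<phi>) l)) \<and>
         (O2_converges G r x l \<longrightarrow>
           (\<exists>(G' :: ('i, 'a) subnet_index set) r' \<phi>.
              subnet_map G r G' r' \<phi> \<and> (antisym r \<longrightarrow> antisym r') \<and>
              O1_converges G' r' (x \<circ> \<phi>) l))"
  \<comment> \<open>The second claim is the case \<open>F = {id}\<close>.\<close>
  using FO2_converges_imp_subnet_FO1_converges[OF assms, of F x l]
    FO2_converges_imp_subnet_FO1_converges[OF assms, of "{id}" x l]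
  by (simp add: FO1_converges_def FO2_converges_def comp_def)

end
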